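(* There exists a constant $c>0$ such that for every positive integer $n$, the position $B$ of the leftmost blockage in the one-dimensional DLA process with parameter $n$ satisfies $$\mathbf{P}\left(B<e^{cn}\right)<e^{-cn}.$$
   Context: **The one-dimensional DLA process with parameter $n$.** Fix a positive integer $n$. Particles are labelled $j=1,2,3,\dots$ and move on $\mathbb{Z}$. The random variable $w(j,t)\in\mathbb{Z}$ ($t=1,2,\dots$) is the location of particle $j$ at time $t$. The process is defined inductively in $j$. - Particle $1$: $w(1,t)=0$ for all $t$. - Suppose the trajectories of particles $1,\dots,j-1$ have been defined ($j>1$), and that for each $j'\le j-1$ the limit $w(j',\infty)=\lim_{t\to\infty}w(j',t)$ exists. For $k\in\mathbb{Z}$ and $i\le j-1$ put $$f(k,i)=\left|\{i'\le i:\ w(i',\infty)=k\}\right|,$$ the number of particles with label at most $i$ that have frozen at $k$. - Particle $j>1$: $w(j,1)=j+2$ and $w(j,2)=j+1$. For $t\ge 2$: if $w(j,t)=w(j,t-1)$, then $w(j,t+1)=w(j,t)$. If $w(j,t)\ne w(j,t-1)$, then, conditionally on the trajectories of particles $1,\dots,j-1$ and on $w(j,1),\dots,w(j,t)$, $$w(j,t+1)=\begin{cases} w(j,t)+1 & \text{with probability } \dfrac{n-f(w(j,t)-1,\,j-1)}{2n},\\[2mm] w(j,t)-1 & \text{with probability } \dfrac{n-f(w(j,t)-1,\,j-1)}{2n},\\[2mm] w(j,t) & \text{with probability } \dfrac{f(w(j,t)-1,\,j-1)}{n}.\end{cases}$$ Almost surely every particle $j$ satisfies $w(j,t)=w(j,t+1)$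 for some $t$, so all the limits $w(j,\infty)$ exist and all these random variables are well defined almost surely. If $w(j,\infty)=k$, we say that particle $j$ freezes at $k$. **Blockage.** There is a blockage at $k\in\mathbb{Z}$ if there exists $i$ with $f(k,i)=n$. Define $$B=\inf\{k:\ \text{there is a blockage at } k\},$$ with $\inf\emptyset=+\infty$.
   Formalization: The bound is stated for every integer n ≥ 2 rather than every positive integer n: for n = 1, particle 1 alone is a blockage at 0, so B ≤ 0 surely and the inequality fails. *)

theory Defs
  imports "HOL-Probability.Probability"
begin

text \<open>
  Trajectories are families \<open>w j t \<omega>\<close> with labels \<open>j \<ge> 1\<close> and times \<open>t \<ge> 1\<close>;
  the values at index \<open>0\<close> play no role.
\<close>

text \<open>Limits in the discrete space of integers: \<open>w(j,\<infinity>) = k\<close>.\<close>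

definition freezes_at :: "(nat \<Rightarrow> nat \<Rightarrow> 'a \<Rightarrow> int) \<Rightarrow> nat \<Rightarrow> int \<Rightarrow> 'a \<Rightarrow> bool" where
  "freezes_at w j k \<omega> \<longleftrightarrow> (\<lambda>t. w j t \<omega>) \<longlonglongrightarrow> k"

text \<open>The number \<open>f(k,i)\<close>; a particle without a limit (a null event) is not counted.\<close>

definition frozen_count :: "(nat \<Rightarrow> nat \<Rightarrow> 'a \<Rightarrow> int) \<Rightarrow> int \<Rightarrow> nat \<Rightarrow> 'a \<Rightarrow> nat" where
  "frozen_count w k i \<omega> = card {i' \<in> {1..i}. freezes_at w i' k \<omega>}"

definition blockage :: "nat \<Rightarrow> (nat \<Rightarrow> nat \<Rightarrow> 'a \<Rightarrow> int) \<Rightarrow> int \<Rightarrow> 'a \<Rightarrow> bool" where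
  "blockage n w k \<omega> \<longleftrightarrow> (\<exists>i. frozen_count w k i \<omega> = n)"

definition leftmost_blockage :: "nat \<Rightarrow> (nat \<Rightarrow> nat \<Rightarrow> 'a \<Rightarrow> int) \<Rightarrow> 'a \<Rightarrow> ereal" where
  "leftmost_blockage n w \<omega> = (INF k \<in> {k. blockage n w k \<omega>}. ereal (real_of_int k))"

text \<open>
  The sigma-algebra generated by the complete trajectories of particles \<open>1, \<dots>, j - 1\<close>
  and by \<open>w(j,1), \<dots>, w(j,t)\<close>.
\<close>

definition dla_history ::
    "'a measure \<Rightarrow> (nat \<Rightarrow> nat \<Rightarrow> 'a \<Rightarrow> int) \<Rightarrow> nat \<Rightarrow> nat \<Rightarrow> 'a measure" where
  "dla_history M w j t = sigma (space M)
     {w i s -` A \<inter> space M | i s A. 1 \<le> i \<and> 1 \<le> s \<and> (i < j \<or> (i = j \<and> s \<le> t))}"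

text \<open>
  The transition probabilities are conditional probabilities given \<^term>\<open>dla_history M w j t\<close>,
  that is, conditional expectations of indicators. They are prescribed only where
  particle \<open>j\<close> has not yet frozen at time \<open>t\<close>.
\<close>

locale dla_process = prob_space M
  for M :: "'a measure" and n :: nat and w :: "nat \<Rightarrow> nat \<Rightarrow> 'a \<Rightarrow> int" +
  assumes n_pos: "n \<ge> 1"
    and w_measurable: "\<And>j t. j \<ge> 1 \<Longrightarrow> t \<ge> 1 \<Longrightarrow> w j t \<in> measurable M (count_space UNIV)"
    and first_particle: "AE \<omega> in M. \<forall>t\<ge>1. w 1 t \<omega> = 0"
    and start: "\<And>j. j > 1 \<Longrightarrow> AE \<omega> in M. w j 1 \<omega> = int j + 2 \<and> w j 2 \<omega> = int j + 1"
    and frozen: "\<And>j t. j > 1 \<Longrightarrow> t \<ge> 2 \<Longrightarrow>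
      AE \<omega> in M. w j t \<omega> = w j (t - 1) \<omega> \<longrightarrow> w j (t + 1) \<omega> = w j t \<omega>"
    and step_right: "\<And>j t. j > 1 \<Longrightarrow> t \<ge> 2 \<Longrightarrow>
      AE \<omega> in M. w j t \<omega> \<noteq> w j (t - 1) \<omega> \<longrightarrow>
        real_cond_exp M (dla_history M w j t)
          (indicator {\<omega>' \<in> space M. w j (t + 1) \<omega>' = w j t \<omega>' + 1}) \<omega>
        = (real n - real (frozen_count w (w j t \<omega> - 1) (j - 1) \<omega>)) / (2 * real n)"
    and step_left: "\<And>j t. j > 1 \<Longrightarrow> t \<ge> 2 \<Longrightarrow>
      AE \<omega> in M. w j t \<omega> \<noteq> w j (t - 1) \<omega> \<longrightarrow>
        real_cond_exp M (dla_history M w j t)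
          (indicator {\<omega>' \<in> space M. w j (t + 1) \<omega>' = w j t \<omega>' - 1}) \<omega>
        = (real n - real (frozen_count w (w j t \<omega> - 1) (j - 1) \<omega>)) / (2 * real n)"
    and step_stay: "\<And>j t. j > 1 \<Longrightarrow> t \<ge> 2 \<Longrightarrow>
      AE \<omega> in M. w j t \<omega> \<noteq> w j (t - 1) \<omega> \<longrightarrow>
        real_cond_exp M (dla_history M w j t)
          (indicator {\<omega>' \<in> space M. w j (t + 1) \<omega>' = w j t \<omega>'}) \<omega>
        = real (frozen_count w (w j t \<omega> - 1) (j - 1) \<omega>) / real n"
begin

lemma subalgebra_dla_history:
  assumes "j \<ge> 1" "t \<ge> 1"
  shows "subalgebra M (dla_history M w j t)"
proof -
  let ?G = "{w i s -` A \<inter> space M | i s A. 1 \<le> i \<and> 1 \<le> s \<and> (i < j \<or> (i = j \<and> s \<le> t))}"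
  have "?G \<subseteq> sets M"
    using w_measurable by (auto intro!: measurable_sets)
  moreover from this have "?G \<subseteq> Pow (space M)"
    using sets.sets_into_space by blast
  ultimately show ?thesis
    unfolding subalgebra_def dla_history_def
    by (simp add: space_measure_of_conv sets.sigma_sets_subset)
qed

lemma freezes_at_iff:
  "freezes_at w i k \<omega> \<longleftrightarrow> (\<exists>N\<ge>1. \<forall>t\<ge>N. w i t \<omega> = k)"
proof -
  have "freezes_at w i k \<omega> \<longleftrightarrow> (\<forall>\<^sub>F t in sequentially. w i t \<omega> = k)"
    unfolding freezes_at_def by (simp add: tendsto_discrete)
  also have "\<dots> \<longleftrightarrow> (\<exists>N\<ge>1. \<forall>t\<ge>N. w i t \<omega> = k)"
    unfolding eventually_sequentially by (metis le_trans nat_le_linear)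
  finally show ?thesis .
qed

lemma pred_freezes_at:
  assumes "i \<ge> 1"
  shows "Measurable.pred M (freezes_at w i k)"
proof -
  have "Measurable.pred M (\<lambda>\<omega>. w i t \<omega> = k)" if "t \<ge> 1" for t
  proof -
    note w_measurable[OF assms that, measurable]
    show ?thesis by measurable
  qed
  then have *: "Measurable.pred M (\<lambda>\<omega>. \<forall>t. w i (t + Suc N) \<omega> = k)" for N
    by (intro pred_intros_countable) simp
  have eq: "freezes_at w i k = (\<lambda>\<omega>. \<exists>N. \<forall>t. w i (t + Suc N) \<omega> = k)"
  proof (rule ext)
    fix \<omega>
    show "freezes_at w i k \<omega> = (\<exists>N. \<forall>t. w i (t + Suc N) \<omega> = k)"
      unfolding freezes_at_iff
    proof safe
      fix N assume "1 \<le> N" "\<forall>t\<ge>N. w i t \<omega> = k"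
      then show "\<exists>N. \<forall>t. w i (t + Suc N) \<omega> = k" by (intro exI[of _ N]) auto
    next
      fix N assume N: "\<forall>t. w i (t + Suc N) \<omega> = k"
      have "w i t \<omega> = k" if "t \<ge> Suc N" for t
        using N[rule_format, of "t - Suc N"] that by simp
      then show "\<exists>N\<ge>1. \<forall>t\<ge>N. w i t \<omega> = k" by (intro exI[of _ "Suc N"]) auto
    qed
  qed
  show ?thesis
    unfolding eq by (rule pred_intros_countable(2)) (rule *)
qed

lemma pred_blockage: "Measurable.pred M (blockage n w k)"
proof -
  have eq: "real (frozen_count w k i \<omega>) = (\<Sum>i'\<in>{1..i}. if freezes_at w i' k \<omega> then 1 else 0)"
    for i \<omega>
    unfolding frozen_count_def by (simp add: sum.If_cases Int_def)
  have "(\<lambda>\<omega>. if freezes_at w i' k \<omega> then 1 else 0 :: real) \<in> borel_measurable M"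
    if "i' \<ge> 1" for i'
  proof -
    note pred_freezes_at[OF that, measurable]
    show ?thesis by measurable
  qed
  then have "(\<lambda>\<omega>. real (frozen_count w k i \<omega>)) \<in> borel_measurable M" for i
    unfolding eq by (intro borel_measurable_sum) auto
  note this[measurable]
  have "Measurable.pred M (\<lambda>\<omega>. \<exists>i. real (frozen_count w k i \<omega>) = real n)"
    by measurable
  then show ?thesis
    by (simp add: blockage_def[abs_def])
qed

lemma leftmost_blockage_less_iff:
  "leftmost_blockage n w \<omega> < x \<longleftrightarrow> (\<exists>k. blockage n w k \<omega> \<and> ereal (real_of_int k) < x)"
  unfolding leftmost_blockage_def by (auto simp: INF_less_iff)

lemma sets_leftmost_blockage_less:
  "{\<omega> \<in> space M. leftmost_blockage n w \<omega> < x} \<in> sets M"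
proof -
  note pred_blockage[measurable]
  show ?thesis
    unfolding leftmost_blockage_less_iff by measurable
qed

text \<open>
  For \<open>n = 1\<close> particle \<open>1\<close> alone is a blockage at \<open>0\<close>, so no exponential bound can hold.
\<close>

lemma prob_leftmost_blockage_less_one:
  assumes "n = 1" "x > 0"
  shows "prob {\<omega> \<in> space M. leftmost_blockage n w \<omega> < x} = 1"
proof -
  have "AE \<omega> in M. leftmost_blockage n w \<omega> < x"
    using first_particle
  proof eventually_elim
    case (elim \<omega>)
    then have "freezes_at w 1 0 \<omega>"
      unfolding freezes_at_iff by blast
    then have "{i' \<in> {1..1}. freezes_at w i' 0 \<omega>} = {1}" by auto
    then have "frozen_count w 0 1 \<omega> = 1"
      unfolding frozen_count_def by simp
    then have "blockage n w 0 \<omega>"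
      unfolding blockage_def using assms by blast
    then show ?case
      unfolding leftmost_blockage_less_iff using assms(2)
      by (intro exI[of _ 0]) (auto simp: zero_ereal_def)
  qed
  then show ?thesis
    using sets_leftmost_blockage_less by (simp add: prob_Collect_eq_1)
qed

end

end

theory Submission
  imports Defs
begin

text \<open>
  A blockage at \<open>k\<close> is exponentially unlikely for each single \<open>k \<ge> 1\<close>, so a union bound over
  \<open>1 \<le> k < e\<^sup>c\<^sup>n\<close> suffices. To freeze at \<open>k\<close>, a particle must first step left from \<open>k + 1\<close>. With
  \<open>a = f(k,\<cdot>)\<close> and \<open>b = f(k+1,\<cdot>)\<close>, a particle standing at \<open>k + 1\<close> freezes there with probability
  \<open>a/n\<close> and steps left with probability \<open>(n - a)/(2n)\<close>. As \<open>a\<close> approaches \<open>n\<close>, freezing at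
  \<open>k + 1\<close> becomes dominant, so \<open>b\<close> tends to reach \<open>n\<close> before \<open>a\<close> does; after that no particle
  gets to \<open>k\<close> any more. This is quantified by a supermartingale \<open>\<Phi>(a,b)\<close> that starts at \<open>1\<close> and
  is at least \<open>(20/19)\<^sup>n\<close> once \<open>a \<ge> n\<close>.
\<close>

lemma measurable_countable_compose2:
  fixes h :: "'c::countable \<Rightarrow> 'd::countable \<Rightarrow> 'e"
  assumes "f \<in> measurable N (count_space UNIV)" "g \<in> measurable N (count_space UNIV)"
    and "\<And>x y. h x y \<in> space N'"
  shows "(\<lambda>\<omega>. h (f \<omega>) (g \<omega>)) \<in> measurable N N'"
  by (rule measurable_compose_countable[OF _ assms(1)],
      rule measurable_compose_countable[OF _ assms(2)]) (use assms(3) in simp)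

section \<open>The potential and its drift\<close>

text \<open>
  The factors of \<open>weight\<close> are chosen to make \<open>pot_step\<close> an equality for \<open>a < n\<close>, \<open>b < n - 1\<close>:
  the expected gain when a particle at \<open>k + 1\<close> steps left balances the factor \<open>3/4\<close> lost when it
  freezes there. The cut-off \<open>min b (n - 1)\<close> keeps \<open>pot\<close> bounded below once \<open>a \<ge> n\<close>.
\<close>

definition weight :: "nat \<Rightarrow> nat \<Rightarrow> real" where
  "weight n a = (\<Prod>i<min a n. 1 + real i / (2 * (real n - real i)))"

definition pot :: "nat \<Rightarrow> nat \<Rightarrow> nat \<Rightarrow> real" where
  "pot n a b = (if b \<ge> n \<and> a < n then 0 else weight n a * (3/4) ^ min b (n - 1))"

lemma weight_0 [simp]: "weight n 0 = 1"
  by (simp add: weight_def)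

lemma weight_Suc:
  "a < n \<Longrightarrow> weight n (Suc a) = weight n a * (1 + real a / (2 * (real n - real a)))"
  by (simp add: weight_def min_def)

lemma weight_ge: "a \<ge> n \<Longrightarrow> weight n a = weight n n"
  by (simp add: weight_def min_def)

lemma weight_ge_1: "weight n a \<ge> 1"
  unfolding weight_def by (intro prod_ge_1) auto

lemma weight_mono: "weight n a \<le> weight n (Suc a)"
proof (cases "a < n")
  case True
  then have "weight n a * 1 \<le> weight n a * (1 + real a / (2 * (real n - real a)))"
    using weight_ge_1[of n a] by (intro mult_left_mono) auto
  then show ?thesis using True by (simp add: weight_Suc)
next
  case False
  then show ?thesis using weight_ge[of n a] weight_ge[of n "Suc a"] by simp
qed

lemma weight_le: "weight n a \<le> weight n n"
proof (cases "a \<le> n")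
  case True
  then show ?thesis by (rule lift_Suc_mono_le[of "weight n", OF weight_mono])
qed (use weight_ge[of n a] in simp)

lemma pot_nonneg: "pot n a b \<ge> 0"
  using weight_ge_1[of n a] by (auto simp: pot_def)

lemma pot_Suc_left: "pot n a b \<le> pot n (Suc a) b"
  using weight_mono[of n a] weight_ge_1[of n a] weight_ge_1[of n "Suc a"] by (auto simp: pot_def)

lemma pot_Suc_right: "pot n a (Suc b) \<le> pot n a b"
  using weight_ge_1[of n a] by (auto simp: pot_def intro!: mult_left_mono power_decreasing)

lemma pot_le: "pot n a b \<le> weight n n"
proof -
  have "weight n a * (3/4) ^ min b (n - 1) \<le> weight n n * 1"
    using weight_ge_1[of n a] weight_ge_1[of n n]
    by (intro mult_mono weight_le power_le_one) auto
  then show ?thesis using weight_ge_1[of n n] by (auto simp: pot_def)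
qed

lemma pot_ge: "a \<ge> n \<Longrightarrow> pot n a b \<ge> weight n n * (3/4) ^ (n - 1)"
  using weight_ge_1[of n n] weight_ge[of n a]
  by (auto simp: pot_def intro!: mult_left_mono power_decreasing)

text \<open>The factor of \<open>weight\<close> at \<open>i = 0\<close> is \<open>1\<close>. This
  makes it harmless that \<open>walk_pot\<close> counts a particle starting at or left of
  \<open>k\<close> as frozen at \<open>k\<close> while that site is still empty. With
  \<open>n \<ge> 2\<close>, one frozen particle does not fill the site, so the zero branch of
  \<open>pot\<close> applies to both sides alike.\<close>

lemma pot_0_1: "n \<ge> 2 \<Longrightarrow> pot n (Suc 0) b = pot n 0 b"
  using weight_Suc[of 0 n] by (auto simp: pot_def)

text \<open>This is the supermartingale inequality for one move of an unfrozen particle at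
  \<open>k + 1\<close>. A move to the right leaves the potential unchanged and contributes no term.
  For \<open>a \<ge> n\<close> the weight has stopped growing, so only the nonpositive freezing term
  remains.\<close>

lemma pot_step:
  assumes "b < n"
  shows "(real n - real a) / (2 * real n) * (pot n (Suc a) b - pot n a b)
    + real a / real n * (pot n a (Suc b) - pot n a b) \<le> 0"
proof (cases "a < n")
  case False
  then have "pot n (Suc a) b = pot n a b"
    using weight_ge[of n a] weight_ge[of n "Suc a"] by (simp add: pot_def)
  then show ?thesis
    using mult_nonneg_nonpos[of "real a / real n" "pot n a (Suc b) - pot n a b"]
      pot_Suc_right[of n a b] by simp
next
  case True
  define P where "P = weight n a * (3/4) ^ b"
  have P: "P \<ge> 0" using weight_ge_1[of n a] by (simp add: P_def)
  have 1: "pot n a b = P" using assms True by (simp add: pot_def P_def min_def)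
  have 2: "pot n (Suc a) b = P * (1 + real a / (2 * (real n - real a)))"
    using assms True by (simp add: pot_def P_def min_def weight_Suc)
  \<comment> \<open>Strict inequality is possible only at \<open>b = n - 1\<close>: freezing then
    fills site \<open>k + 1\<close> and the potential drops to \<open>0\<close>.\<close>
  have 3: "pot n a (Suc b) \<le> 3/4 * P"
    using assms True P by (auto simp: pot_def P_def min_def)
  have "real a / real n * (pot n a (Suc b) - P) \<le> real a / real n * (- 1/4 * P)"
    using 3 assms by (intro mult_left_mono) auto
  moreover have "(real n - real a) / (2 * real n) * (P * (1 + real a / (2 * (real n - real a))) - P)
      = real a / real n * (1/4 * P)"
    using True by (simp add: field_simps)
  ultimately show ?thesis unfolding 1 2 by simp
qed

section \<open>Exponential growth of the final weight\<close>

lemma prod_falling: "r \<le> N \<Longrightarrow> (\<Prod>i<r. real N - real i) * fact (N - r) = (fact N :: real)"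
proof (induction r)
  case (Suc r)
  then have "N - r = Suc (N - Suc r)" by simp
  then have "(fact (N - r) :: real) = real (N - r) * fact (N - Suc r)"
    using fact_Suc[of "N - Suc r", where 'a = real] by (simp only:)
  then show ?case using Suc by (simp add: mult_ac of_nat_diff)
qed simp

text \<open>Each factor equals \<open>(2n - i) / (2(n - i))\<close>, so the product is the central
  binomial coefficient divided by \<open>2 ^ n\<close>.\<close>

lemma weight_eq: "weight n n = fact (2 * n) / (2 ^ n * fact n * fact n)"
proof -
  have "weight n n = (\<Prod>i<n. (real (2 * n) - real i) / (2 * (real n - real i)))"
    unfolding weight_def by (auto simp: field_simps intro!: prod.cong)
  also have "\<dots> = (\<Prod>i<n. real (2 * n) - real i) / (2 ^ n * (\<Prod>i<n. real n - real i))"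
    by (simp only: prod_dividef prod.distrib prod_constant card_lessThan)
  also have "(\<Prod>i<n. real n - real i) = fact n"
    using prod_falling[of n n] by simp
  also have "(\<Prod>i<n. real (2 * n) - real i) = fact (2 * n) / fact n"
    using prod_falling[of n "2 * n"] by (simp add: field_simps)
  finally show ?thesis by simp
qed

text \<open>Passing from \<open>n\<close> to \<open>n + 1\<close> multiplies the right side by
  \<open>(3/4)(2n + 1)/(n + 1)\<close>, which is at least \<open>5/4\<close> from
  \<open>n = 2\<close> on. The constant \<open>20/19\<close> is limited by the base case: at
  \<open>n = 2\<close> the right side is \<open>9/8\<close>, just above
  \<open>(20/19)^2\<close>.\<close>

lemma weight_bound:
  assumes "n \<ge> 2"
  shows "(20/19) ^ n \<le> weight n n * (3/4) ^ (n - 1)"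
  using assms
proof (induction rule: dec_induct)
  case base
  show ?case unfolding weight_eq by (simp add: fact_numeral power2_eq_square)
next
  case (step n)
  have "(fact (2 * Suc n) :: real) = (2 * real n + 2) * (2 * real n + 1) * fact (2 * n)"
    by (simp add: algebra_simps)
  then have eq: "weight (Suc n) (Suc n) = weight n n * ((2 * real n + 1) / (real n + 1))"
    unfolding weight_eq by (simp add: divide_simps) (simp add: algebra_simps)
  have pw: "(3/4 :: real) ^ (Suc n - 1) = (3/4) ^ (n - 1) * (3/4)"
    using step(1) by (cases n) auto
  have "(20/19 :: real) ^ Suc n = (20/19) ^ n * (20/19)" by simp
  also have "\<dots> \<le> (weight n n * (3/4) ^ (n - 1)) * ((2 * real n + 1) / (real n + 1) * (3/4))"
    using step weight_ge_1[of n n] by (intro mult_mono) (auto simp: field_simps)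
  finally show ?case unfolding eq pw by (simp add: field_simps)
qed

section \<open>Measurability and use of the conditional probabilities\<close>

context dla_process
begin

lemma measurable_dla_history:
  assumes "1 \<le> i" "1 \<le> s" "i < j \<or> i = j \<and> s \<le> t"
  shows "w i s \<in> measurable (dla_history M w j t) (count_space UNIV)"
proof -
  let ?G = "{w i s -` A \<inter> space M | i s A. 1 \<le> i \<and> 1 \<le> s \<and> (i < j \<or> (i = j \<and> s \<le> t))}"
  have G: "?G \<subseteq> Pow (space M)" by auto
  show ?thesis
  proof (rule measurableI)
    fix A assume "A \<in> sets (count_space (UNIV :: int set))"
    have "w i s -` A \<inter> space M \<in> ?G" using assms by blast
    then show "w i s -` A \<inter> space (dla_history M w j t) \<in> sets (dla_history M w j t)"
      unfolding dla_history_def using G by (simp add: space_measure_of_conv sigma_sets.Basic)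
  qed simp
qed

text \<open>The sigma-algebra \<open>N\<close> is left general because the counts must be measurable
  with respect to \<open>dla_history\<close>, not only with respect to \<open>M\<close>.\<close>

lemma pred_freezes_at_wrt:
  assumes "\<And>s. s \<ge> 1 \<Longrightarrow> w i s \<in> measurable N (count_space UNIV)"
  shows "Measurable.pred N (freezes_at w i k)"
proof -
  have *: "Measurable.pred N (\<lambda>\<omega>. \<forall>t. w i (t + Suc m) \<omega> = k)" for m
  proof (rule pred_intros_countable)
    fix t
    note assms[of "t + Suc m", simplified, measurable]
    show "Measurable.pred N (\<lambda>\<omega>. w i (t + Suc m) \<omega> = k)" by simp
  qed
  have eq: "freezes_at w i k = (\<lambda>\<omega>. \<exists>m. \<forall>t. w i (t + Suc m) \<omega> = k)"
  proof (rule ext)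
    fix \<omega>
    have "(\<exists>m. \<forall>t. w i (t + Suc m) \<omega> = k) \<longleftrightarrow> (\<exists>N\<ge>1. \<forall>t\<ge>N. w i t \<omega> = k)"
      by (metis One_nat_def Suc_le_D add.commute le_Suc_ex le_add1 plus_1_eq_Suc)
    then show "freezes_at w i k \<omega> = (\<exists>m. \<forall>t. w i (t + Suc m) \<omega> = k)"
      unfolding freezes_at_iff by simp
  qed
  show ?thesis
    unfolding eq by (rule pred_intros_countable(2)) (rule *)
qed

lemma measurable_frozen_count:
  assumes "\<And>i s. 1 \<le> i \<Longrightarrow> i \<le> m \<Longrightarrow> s \<ge> 1 \<Longrightarrow> w i s \<in> measurable N (count_space UNIV)"
  shows "frozen_count w k m \<in> measurable N (count_space UNIV)"
proof -
  have eq: "frozen_count w k m = (\<lambda>\<omega>. \<Sum>i\<in>{1..m}. if freezes_at w i k \<omega> then 1 else 0)"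
    unfolding frozen_count_def by (simp add: sum.If_cases Int_def fun_eq_iff)
  show ?thesis unfolding eq
  proof (intro measurable_sum_nat)
    fix i assume "i \<in> {1..m}"
    then have [measurable]: "Measurable.pred N (freezes_at w i k)"
      using assms by (intro pred_freezes_at_wrt) auto
    show "(\<lambda>\<omega>. if freezes_at w i k \<omega> then 1 else 0 :: nat) \<in> measurable N (count_space UNIV)"
      by measurable
  qed
qed

lemma frozen_count_le: "frozen_count w k m \<omega> \<le> m"
proof -
  have "frozen_count w k m \<omega> \<le> card {1..m}"
    unfolding frozen_count_def by (intro card_mono) auto
  then show ?thesis by simp
qed

lemma frozen_count_Suc:
  "frozen_count w k (Suc m) \<omega> = frozen_count w k m \<omega> + of_bool (freezes_at w (Suc m) k \<omega>)"
proof -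
  have "{i \<in> {1..Suc m}. freezes_at w i k \<omega>} = {i \<in> {1..m}. freezes_at w i k \<omega>} \<union>
     (if freezes_at w (Suc m) k \<omega> then {Suc m} else {})"
    by (auto simp: le_Suc_eq)
  then show ?thesis unfolding frozen_count_def by auto
qed

lemma frozen_count_history:
  "j \<ge> 1 \<Longrightarrow> frozen_count w k (j - 1) \<in> measurable (dla_history M w j t) (count_space UNIV)"
  by (intro measurable_frozen_count measurable_dla_history) auto

lemma frozen_count_at_history:
  assumes "j \<ge> 1" "t \<ge> 1"
  shows "(\<lambda>\<omega>. frozen_count w (w j t \<omega> - 1) (j - 1) \<omega>)
    \<in> measurable (dla_history M w j t) (count_space UNIV)"
  using assms
  by (intro measurable_compose_countable[where g = "w j t" and
        f = "\<lambda>x \<omega>. frozen_count w (x - 1) (j - 1) \<omega>"]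
      frozen_count_history measurable_dla_history) auto

text \<open>Transition probabilities enter through this rule: under an integral against a bounded
  history-measurable \<open>F\<close>, the indicator of a step may be replaced by its prescribed
  probability. The prescription is required only where \<open>F\<close> is nonzero, so
  \<open>F\<close> can carry the condition that the particle is still moving.\<close>

lemma integral_cond_prob:
  assumes jt: "j \<ge> 1" "t \<ge> 1"
    and F: "F \<in> borel_measurable (dla_history M w j t)" "\<And>\<omega>. \<bar>F \<omega>\<bar> \<le> (C::real)"
    and S: "S \<in> sets M"
    and p[measurable]: "p \<in> borel_measurable M"
    and AE: "AE \<omega> in M. F \<omega> \<noteq> 0 \<longrightarrow>
      real_cond_exp M (dla_history M w j t) (indicator S) \<omega> = p \<omega>"
  shows "(\<integral>\<omega>. F \<omega> * indicator S \<omega> \<partial>M) = (\<integral>\<omega>. F \<omega> * p \<omega> \<partial>M)"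
    "integrable M (\<lambda>\<omega>. F \<omega> * indicator S \<omega>)"
proof -
  let ?H = "dla_history M w j t"
  have sub: "subalgebra M ?H" using jt by (rule subalgebra_dla_history)
  interpret H: finite_measure_subalgebra M ?H
    by unfold_locales (use sub in auto)
  have FM: "F \<in> borel_measurable M" by (rule measurable_from_subalg[OF sub F(1)])
  note S[measurable] FM[measurable]
  have "\<bar>F \<omega>\<bar> * indicator S \<omega> \<le> C" for \<omega>
    using F(2)[of \<omega>] by (auto simp: indicator_def)
  then show int: "integrable M (\<lambda>\<omega>. F \<omega> * indicator S \<omega>)"
    by (intro integrable_const_bound[of _ C]) (auto simp: abs_mult)
  have "(\<integral>\<omega>. F \<omega> * indicator S \<omega> \<partial>M) = (\<integral>\<omega>. F \<omega> * real_cond_exp M ?H (indicator S) \<omega> \<partial>M)"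
    by (rule H.real_cond_exp_intg(2)[symmetric, OF int F(1)]) simp
  also have "\<dots> = (\<integral>\<omega>. F \<omega> * p \<omega> \<partial>M)"
  proof -
    show ?thesis
      using AE by (intro integral_cong_AE) auto
  qed
  finally show "(\<integral>\<omega>. F \<omega> * indicator S \<omega> \<partial>M) = (\<integral>\<omega>. F \<omega> * p \<omega> \<partial>M)" .
qed

text \<open>On \<open>A\<close> the integral of the indicator equals that of \<open>p\<close>, hence
  is both nonnegative and nonpositive. The form \<open>p \<omega> \<le> 0\<close> suits the
  expression \<open>(n - f) / (2n)\<close>, which is formally negative for
  \<open>f > n\<close>.\<close>

lemma cond_prob_nonpos_imp_null:
  assumes jt: "j \<ge> 1" "t \<ge> 1"
    and A: "Measurable.pred (dla_history M w j t) A"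
    and S: "S \<in> sets M"
    and p: "p \<in> borel_measurable M"
    and AE: "AE \<omega> in M. A \<omega> \<longrightarrow>
      real_cond_exp M (dla_history M w j t) (indicator S) \<omega> = p \<omega> \<and> p \<omega> \<le> 0"
  shows "AE \<omega> in M. A \<omega> \<longrightarrow> \<omega> \<notin> S"
proof -
  let ?F = "\<lambda>\<omega>. of_bool (A \<omega>) :: real"
  note A[measurable]
  have F: "?F \<in> borel_measurable (dla_history M w j t)" by measurable
  have AE': "AE \<omega> in M. ?F \<omega> \<noteq> 0 \<longrightarrow>
      real_cond_exp M (dla_history M w j t) (indicator S) \<omega> = p \<omega>"
    using AE by eventually_elim auto
  have *: "(\<integral>\<omega>. ?F \<omega> * indicator S \<omega> \<partial>M) = (\<integral>\<omega>. ?F \<omega> * p \<omega> \<partial>M)"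
    "integrable M (\<lambda>\<omega>. ?F \<omega> * indicator S \<omega>)"
    using integral_cond_prob[OF jt F _ S p AE', of 1] by auto
  have "AE \<omega> in M. 0 \<le> - (?F \<omega> * p \<omega>)"
    using AE by eventually_elim auto
  from integral_nonneg_AE[OF this] have "(\<integral>\<omega>. ?F \<omega> * indicator S \<omega> \<partial>M) \<le> 0" using *(1) by simp
  moreover have "(\<integral>\<omega>. ?F \<omega> * indicator S \<omega> \<partial>M) \<ge> 0"
    by (intro integral_nonneg_AE) auto
  ultimately have "(\<integral>\<omega>. ?F \<omega> * indicator S \<omega> \<partial>M) = 0" by simp
  then have "AE \<omega> in M. ?F \<omega> * indicator S \<omega> = 0"
    using integral_nonneg_eq_0_iff_AE[OF *(2)] by auto
  then show ?thesis by eventually_elim (auto simp: indicator_def split: if_splits)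
qed

lemma sets_step:
  assumes "j \<ge> 1" "t \<ge> 1"
  shows "{\<omega> \<in> space M. w j (t + 1) \<omega> = w j t \<omega> + d} \<in> sets M"
proof -
  note w_measurable[OF assms, measurable]
  have [measurable]: "w j (t + 1) \<in> measurable M (count_space UNIV)"
    using assms by (intro w_measurable) auto
  show ?thesis by measurable
qed

lemma frozen_count_at_measurable:
  assumes "j \<ge> 1" "t \<ge> 1"
  shows "(\<lambda>\<omega>. frozen_count w (w j t \<omega> - 1) (j - 1) \<omega>) \<in> measurable M (count_space UNIV)"
  by (rule measurable_from_subalg[OF subalgebra_dla_history[OF assms]
      frozen_count_at_history[OF assms]])

lemma frozen_count_measurable:
  "frozen_count w k m \<in> measurable M (count_space UNIV)"
  by (intro measurable_frozen_count w_measurable)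

lemma unfrozen_history:
  assumes "j \<ge> 1" "t \<ge> 2"
  shows "Measurable.pred (dla_history M w j t) (\<lambda>\<omega>. w j t \<omega> \<noteq> w j (t - 1) \<omega>)"
proof -
  have [measurable]: "w j t \<in> measurable (dla_history M w j t) (count_space UNIV)"
    "w j (t - 1) \<in> measurable (dla_history M w j t) (count_space UNIV)"
    using assms by (auto intro!: measurable_dla_history)
  show ?thesis by measurable
qed

section \<open>Almost sure properties of the trajectories\<close>

text \<open>The three prescribed probabilities add up to \<open>1\<close>, so no mass is left for
  any other move.\<close>

lemma AE_nearest_neighbour:
  assumes j: "j > 1" and t: "t \<ge> 2"
  shows "AE \<omega> in M. w j t \<omega> \<noteq> w j (t - 1) \<omega> \<longrightarrow>
    w j (t + 1) \<omega> \<in> {w j t \<omega> + 1, w j t \<omega> - 1, w j t \<omega>}"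
proof -
  let ?U = "\<lambda>\<omega>. w j t \<omega> \<noteq> w j (t - 1) \<omega>"
  let ?F = "\<lambda>\<omega>. of_bool (?U \<omega>) :: real"
  let ?f = "\<lambda>\<omega>. real (frozen_count w (w j t \<omega> - 1) (j - 1) \<omega>)"
  let ?S = "\<lambda>d. {\<omega> \<in> space M. w j (t + 1) \<omega> = w j t \<omega> + d}"
  have jt: "j \<ge> 1" "t \<ge> 1" using j t by auto
  note frozen_count_at_measurable[OF jt, measurable]
  note unfrozen_history[OF jt(1) t, measurable]
  have F: "?F \<in> borel_measurable (dla_history M w j t)" by measurable
  have FM[measurable]: "?F \<in> borel_measurable M"
    by (rule measurable_from_subalg[OF subalgebra_dla_history[OF jt] F])
  have f_bd: "\<bar>?F \<omega> * ?f \<omega>\<bar> \<le> real j" for \<omega>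
    using frozen_count_le[of "w j t \<omega> - 1" "j - 1" \<omega>] by auto
  have fM: "(\<lambda>\<omega>. ?F \<omega> * ?f \<omega>) \<in> borel_measurable M"
    by (intro borel_measurable_times FM) measurable
  have int: "integrable M (\<lambda>\<omega>. ?F \<omega> * ?f \<omega>)" "integrable M ?F"
    by (rule integrable_const_bound[of _ "real j", OF _ fM], use f_bd in simp)
      (rule integrable_const_bound[of _ 1, OF _ FM], simp)
  have F_bd: "\<bar>?F \<omega>\<bar> \<le> 1" for \<omega> by simp
  have p: "(\<lambda>\<omega>. (real n - ?f \<omega>) / (2 * real n)) \<in> borel_measurable M"
    "(\<lambda>\<omega>. ?f \<omega> / real n) \<in> borel_measurable M" by measurable
  have AE_r: "AE \<omega> in M. ?F \<omega> \<noteq> 0 \<longrightarrow>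
      real_cond_exp M (dla_history M w j t) (indicator (?S 1)) \<omega> = (real n - ?f \<omega>) / (2 * real n)"
    using step_right[OF j t] by eventually_elim simp
  have AE_l: "AE \<omega> in M. ?F \<omega> \<noteq> 0 \<longrightarrow>
      real_cond_exp M (dla_history M w j t) (indicator (?S (-1))) \<omega> = (real n - ?f \<omega>) / (2 * real n)"
    using step_left[OF j t] by eventually_elim simp
  have AE_s: "AE \<omega> in M. ?F \<omega> \<noteq> 0 \<longrightarrow>
      real_cond_exp M (dla_history M w j t) (indicator (?S 0)) \<omega> = ?f \<omega> / real n"
    using step_stay[OF j t] by eventually_elim simp
  note r = integral_cond_prob[OF jt F F_bd sets_step[OF jt] p(1) AE_r]
  note l = integral_cond_prob[OF jt F F_bd sets_step[OF jt] p(1) AE_l]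
  note s = integral_cond_prob[OF jt F F_bd sets_step[OF jt] p(2) AE_s]
  \<comment> \<open>\<open>?R\<close> is the indicator that a moving particle makes none of the
    three moves. It is nonnegative and its integral vanishes, hence it is almost surely
    zero.\<close>
  let ?R = "\<lambda>\<omega>. ?F \<omega> - (?F \<omega> * indicator (?S 1) \<omega> + ?F \<omega> * indicator (?S (-1)) \<omega> + ?F \<omega> * indicator (?S 0) \<omega>)"
  have eq: "?F \<omega> * ((real n - ?f \<omega>) / (2 * real n)) = ?F \<omega> / 2 - ?F \<omega> * ?f \<omega> / (2 * real n)" for \<omega>
    using n_pos by (simp add: field_simps)
  have intR: "integrable M ?R"
    by (intro Bochner_Integration.integrable_diff Bochner_Integration.integrable_add int r(2) l(2) s(2))
  have "(\<integral>\<omega>. ?R \<omega> \<partial>M) = (\<integral>\<omega>. ?F \<omega> \<partial>M) - ((\<integral>\<omega>. ?F \<omega> * indicator (?S 1) \<omega> \<partial>M)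
     + (\<integral>\<omega>. ?F \<omega> * indicator (?S (-1)) \<omega> \<partial>M) + (\<integral>\<omega>. ?F \<omega> * indicator (?S 0) \<omega> \<partial>M))"
    using int(2) r(2) l(2) s(2)
    by (simp only: Bochner_Integration.integral_diff Bochner_Integration.integral_add
      Bochner_Integration.integrable_diff Bochner_Integration.integrable_add)
  also have "\<dots> = 0"
    unfolding r(1) l(1) s(1) eq using int by simp
  finally have R0: "(\<integral>\<omega>. ?R \<omega> \<partial>M) = 0" .
  have "?R \<omega> \<ge> 0" for \<omega>
    by (auto simp: indicator_def)
  then have "AE \<omega> in M. ?R \<omega> = 0"
    using integral_nonneg_eq_0_iff_AE[OF intR] R0 by auto
  then show ?thesis
    using AE_space by eventually_elim (auto simp: indicator_def split: if_splits)
qed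

lemma frozen_stays:
  assumes frz: "\<And>t. t \<ge> 2 \<Longrightarrow> w j t \<omega> = w j (t - 1) \<omega> \<longrightarrow> w j (t + 1) \<omega> = w j t \<omega>"
    and "t \<ge> 1" "w j (t + 1) \<omega> = w j t \<omega>" "s \<ge> t"
  shows "w j s \<omega> = w j t \<omega>"
proof -
  have "w j (s + 1) \<omega> = w j s \<omega> \<and> w j s \<omega> = w j t \<omega>"
    using assms(4)
  proof (induction rule: dec_induct)
    case (step s)
    then show ?case using frz[of "Suc s"] assms(2) by auto
  qed (use assms(2,3) in simp)
  then show ?thesis by simp
qed

text \<open>A moving particle stays put with probability proportional to the count at its left
  neighbour, so it almost surely never stops beside an empty site.\<close>

lemma AE_freezes_beside_frozen:
  assumes j: "j > 1"
  shows "AE \<omega> in M. \<forall>k. freezes_at w j k \<omega> \<longrightarrow> frozen_count w (k - 1) (j - 1) \<omega> > 0"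
proof -
  have *: "AE \<omega> in M. \<forall>t\<in>{2..}. w j t \<omega> \<noteq> w j (t - 1) \<omega> \<and>
      frozen_count w (w j t \<omega> - 1) (j - 1) \<omega> = 0 \<longrightarrow> w j (t + 1) \<omega> \<noteq> w j t \<omega>"
  proof (intro AE_ball_countable[THEN iffD2] ballI)
    fix t :: nat assume "t \<in> {2..}"
    then have jt: "j \<ge> 1" "t \<ge> 1" "t \<ge> 2" using j by auto
    let ?f = "\<lambda>\<omega>. frozen_count w (w j t \<omega> - 1) (j - 1) \<omega>"
    let ?A = "\<lambda>\<omega>. w j t \<omega> \<noteq> w j (t - 1) \<omega> \<and> ?f \<omega> = 0"
    note frozen_count_at_measurable[OF jt(1,2), measurable]
    note frozen_count_at_history[OF jt(1,2), measurable]
    note unfrozen_history[OF jt(1,3), measurable]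
    have A: "Measurable.pred (dla_history M w j t) ?A" by measurable
    have p: "(\<lambda>\<omega>. real (?f \<omega>) / real n) \<in> borel_measurable M" by measurable
    have AE: "AE \<omega> in M. ?A \<omega> \<longrightarrow> real_cond_exp M (dla_history M w j t)
        (indicator {\<omega> \<in> space M. w j (t + 1) \<omega> = w j t \<omega> + 0}) \<omega> = real (?f \<omega>) / real n
        \<and> real (?f \<omega>) / real n \<le> 0"
      using step_stay[OF j jt(3)] by eventually_elim simp
    note cond_prob_nonpos_imp_null[OF jt(1,2) A sets_step[OF jt(1,2)] p AE]
    then show "AE \<omega> in M. ?A \<omega> \<longrightarrow> w j (t + 1) \<omega> \<noteq> w j t \<omega>"
      using AE_space by eventually_elim auto
  qed auto
  have frz: "AE \<omega> in M. \<forall>t\<in>{2..}. w j t \<omega> = w j (t - 1) \<omega> \<longrightarrow> w j (t + 1) \<omega> = w j t \<omega>"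
    using frozen[OF j] by (intro AE_ball_countable[THEN iffD2] ballI) auto
  from * frz start[OF j] show ?thesis
  proof eventually_elim
    case (elim \<omega>)
    show ?case
    proof (intro allI impI)
      fix k assume "freezes_at w j k \<omega>"
      then obtain N where N: "N \<ge> 1" "\<And>t. t \<ge> N \<Longrightarrow> w j t \<omega> = k"
        unfolding freezes_at_iff by auto
      \<comment> \<open>The first repetition of a position: just before it the particle is still
        moving, as \<open>*\<close> requires. It is not at time \<open>1\<close>, since the two
        prescribed starting positions differ.\<close>
      define t where "t = (LEAST t. t \<ge> 1 \<and> w j (t + 1) \<omega> = w j t \<omega>)"
      have t: "t \<ge> 1 \<and> w j (t + 1) \<omega> = w j t \<omega>"
        unfolding t_def by (rule LeastI[of _ N]) (use N in auto)
      have "t \<noteq> 1" using t elim(3) by (auto simp: numeral_2_eq_2)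
      then have t2: "t \<ge> 2" using t by simp
      have "w j t \<omega> \<noteq> w j (t - 1) \<omega>"
        using not_less_Least[of "t - 1" "\<lambda>t. t \<ge> 1 \<and> w j (t + 1) \<omega> = w j t \<omega>"] t2
        unfolding t_def[symmetric] by auto
      then have "frozen_count w (w j t \<omega> - 1) (j - 1) \<omega> \<noteq> 0"
        using elim(1) t t2 by auto
      moreover have "w j s \<omega> = w j (s - 1) \<omega> \<longrightarrow> w j (s + 1) \<omega> = w j s \<omega>" if "s \<ge> 2" for s
        using elim(2) that by blast
      then have "w j (max N t) \<omega> = w j t \<omega>"
        by (rule frozen_stays) (use t in simp_all)
      ultimately show "frozen_count w (k - 1) (j - 1) \<omega> > 0"
        using N(2)[of "max N t"] by simp
    qed
  qed
qed

definition supported :: "'a \<Rightarrow> bool" where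
  "supported \<omega> \<longleftrightarrow> freezes_at w 1 0 \<omega> \<and>
    (\<forall>j\<ge>2. \<forall>k. freezes_at w j k \<omega> \<longrightarrow> 1 \<le> k \<and> k < int j)"

lemma freezes_at_unique: "freezes_at w j k \<omega> \<Longrightarrow> freezes_at w j l \<omega> \<Longrightarrow> k = l"
  unfolding freezes_at_def by (rule LIMSEQ_unique)

text \<open>Strong induction on the label. A particle freezing at \<open>k\<close> has an earlier
  one frozen at \<open>k - 1\<close>; that is either particle \<open>1\<close> at \<open>0\<close>,
  or one to which the induction hypothesis applies.\<close>

lemma AE_support: "AE \<omega> in M. supported \<omega>"
proof -
  have "AE \<omega> in M. \<forall>j\<in>{2..}. \<forall>k. freezes_at w j k \<omega> \<longrightarrow> frozen_count w (k - 1) (j - 1) \<omega> > 0"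
    using AE_freezes_beside_frozen by (intro AE_ball_countable[THEN iffD2] ballI) auto
  from this first_particle show ?thesis
  proof eventually_elim
    case (elim \<omega>)
    have 1: "freezes_at w 1 0 \<omega>" using elim(2) unfolding freezes_at_iff by blast
    have "1 \<le> k \<and> k < int j" if "j \<ge> 2" "freezes_at w j k \<omega>" for j k
      using that
    proof (induction j arbitrary: k rule: less_induct)
      case (less j)
      then have "frozen_count w (k - 1) (j - 1) \<omega> > 0" using elim(1) by auto
      then obtain i where i: "1 \<le> i" "i \<le> j - 1" "freezes_at w i (k - 1) \<omega>"
        unfolding frozen_count_def card_gt_0_iff by auto
      show ?case
      proof (cases "i = 1")
        case True
        then have "k - 1 = 0" using i 1 freezes_at_unique by blast
        then show ?thesis using less(2) by simp
      next
        case False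
        then show ?thesis using less(1)[OF _ _ i(3)] i less(2) by fastforce
      qed
    qed
    then show ?case using 1 unfolding supported_def by blast
  qed
qed

text \<open>A full site \<open>k + 1\<close> is a barrier: a step left from \<open>k + 2\<close> has
  probability \<open>0\<close>, and nearest-neighbour moves cannot jump over it.\<close>

lemma AE_not_freezes_beyond_full_site:
  assumes j: "j > 1"
  shows "AE \<omega> in M. frozen_count w (k + 1) (j - 1) \<omega> \<ge> n \<longrightarrow> \<not> freezes_at w j k \<omega>"
proof -
  have *: "AE \<omega> in M. \<forall>t\<in>{2..}. w j t \<omega> \<noteq> w j (t - 1) \<omega> \<and> w j t \<omega> = k + 2 \<and>
      frozen_count w (k + 1) (j - 1) \<omega> \<ge> n \<longrightarrow> w j (t + 1) \<omega> \<noteq> w j t \<omega> - 1"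
  proof (intro AE_ball_countable[THEN iffD2] ballI)
    fix t :: nat assume "t \<in> {2..}"
    then have jt: "j \<ge> 1" "t \<ge> 1" "t \<ge> 2" using j by auto
    let ?f = "\<lambda>\<omega>. frozen_count w (w j t \<omega> - 1) (j - 1) \<omega>"
    let ?A = "\<lambda>\<omega>. w j t \<omega> \<noteq> w j (t - 1) \<omega> \<and> w j t \<omega> = k + 2 \<and> frozen_count w (k + 1) (j - 1) \<omega> \<ge> n"
    note frozen_count_at_measurable[OF jt(1,2), measurable]
    note frozen_count_history[OF jt(1), measurable]
    note unfrozen_history[OF jt(1,3), measurable]
    have [measurable]: "w j t \<in> measurable (dla_history M w j t) (count_space UNIV)"
      using jt by (auto intro!: measurable_dla_history)
    have A: "Measurable.pred (dla_history M w j t) ?A" by measurable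
    have p: "(\<lambda>\<omega>. (real n - real (?f \<omega>)) / (2 * real n)) \<in> borel_measurable M" by measurable
    have AE: "AE \<omega> in M. ?A \<omega> \<longrightarrow> real_cond_exp M (dla_history M w j t)
        (indicator {\<omega> \<in> space M. w j (t + 1) \<omega> = w j t \<omega> + (-1)}) \<omega>
          = (real n - real (?f \<omega>)) / (2 * real n)
        \<and> (real n - real (?f \<omega>)) / (2 * real n) \<le> 0"
      using step_left[OF j jt(3)] by eventually_elim (auto simp: divide_le_0_iff add_diff_eq[symmetric])
    note cond_prob_nonpos_imp_null[OF jt(1,2) A sets_step[OF jt(1,2)] p AE]
    then show "AE \<omega> in M. ?A \<omega> \<longrightarrow> w j (t + 1) \<omega> \<noteq> w j t \<omega> - 1"
      using AE_space by eventually_elim auto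
  qed auto
  have frz: "AE \<omega> in M. \<forall>t\<in>{2..}. w j t \<omega> = w j (t - 1) \<omega> \<longrightarrow> w j (t + 1) \<omega> = w j t \<omega>"
    using frozen[OF j] by (intro AE_ball_countable[THEN iffD2] ballI) auto
  have nn: "AE \<omega> in M. \<forall>t\<in>{2..}. w j t \<omega> \<noteq> w j (t - 1) \<omega> \<longrightarrow>
    w j (t + 1) \<omega> \<in> {w j t \<omega> + 1, w j t \<omega> - 1, w j t \<omega>}"
    using AE_nearest_neighbour[OF j] by (intro AE_ball_countable[THEN iffD2] ballI) auto
  from * frz nn start[OF j] AE_support show ?thesis
  proof eventually_elim
    case (elim \<omega>)
    show ?case
    proof
      assume b: "frozen_count w (k + 1) (j - 1) \<omega> \<ge> n"
      then have "frozen_count w (k + 1) (j - 1) \<omega> > 0" using n_pos by simp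
      then obtain i where i: "1 \<le> i" "i \<le> j - 1" "freezes_at w i (k + 1) \<omega>"
        unfolding frozen_count_def card_gt_0_iff by auto
      \<comment> \<open>By \<open>supported\<close>, an earlier particle frozen at
        \<open>k + 1\<close> has a label above \<open>k + 1\<close>. Hence the new particle starts
        to the right of the barrier.\<close>
      have "k + 1 < int i"
      proof (cases "i = 1")
        case True
        then show ?thesis using i freezes_at_unique elim(5) unfolding supported_def by force
      next
        case False
        then show ?thesis using i elim(5) unfolding supported_def by auto
      qed
      then have j2: "int j + 1 \<ge> k + 2" using i by auto
      have ge: "w j t \<omega> \<ge> k + 2" if "t \<ge> 2" for t using that
      proof (induction t rule: dec_induct)
        case base
        then show ?case using elim(4) j2 by simp
      next
        case (step t)
        show ?case
        proof (cases "w j t \<omega> = w j (t - 1) \<omega>")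
          case True
          then show ?thesis using elim(2) step by auto
        next
          case False
          then have a: "w j (Suc t) \<omega> \<in> {w j t \<omega> + 1, w j t \<omega> - 1, w j t \<omega>}"
            using elim(3) step(1) by auto
          have c: "w j t \<omega> = k + 2 \<Longrightarrow> w j (Suc t) \<omega> \<noteq> w j t \<omega> - 1"
            using elim(1) step(1) False b by auto
          show ?thesis using a c step.IH by (cases "w j t \<omega> = k + 2") auto
        qed
      qed
      show "\<not> freezes_at w j k \<omega>"
      proof
        assume "freezes_at w j k \<omega>"
        then obtain N where "\<And>t. t \<ge> N \<Longrightarrow> w j t \<omega> = k"
          unfolding freezes_at_iff by auto
        then have "w j (max N 2) \<omega> = k" by simp
        then show False using ge[of "max N 2"] by simp
      qed
    qed
  qed
qed

section \<open>The potential along the walk of one particle\<close>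

text \<open>
  A particle at or to the left of \<open>k\<close> is counted as already frozen at \<open>k\<close>. This can only
  overestimate \<open>pot\<close>, and it makes the step from \<open>k + 1\<close> to \<open>k\<close> the only one that raises it.
\<close>

definition walk_pot :: "int \<Rightarrow> nat \<Rightarrow> nat \<Rightarrow> 'a \<Rightarrow> real" where
  "walk_pot k j t \<omega> = (let a = frozen_count w k (j - 1) \<omega>; b = frozen_count w (k + 1) (j - 1) \<omega> in
     if b \<ge> n then pot n a b
     else pot n (a + of_bool (w j t \<omega> \<le> k)) (b + of_bool (w j t \<omega> = k + 1 \<and> w j (t - 1) \<omega> = k + 1)))"

definition site_pot :: "int \<Rightarrow> nat \<Rightarrow> 'a \<Rightarrow> real" where
  "site_pot k j \<omega> = pot n (frozen_count w k j \<omega>) (frozen_count w (k + 1) j \<omega>)"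

lemma site_pot_measurable [measurable]: "site_pot k j \<in> borel_measurable M"
  unfolding site_pot_def
  by (rule measurable_countable_compose2[where h = "pot n"]) (auto intro: frozen_count_measurable)

lemma walk_pot_measurable:
  assumes "j \<ge> 1" "t \<ge> 2"
  shows "walk_pot k j t \<in> borel_measurable M"
proof -
  have a: "frozen_count w k (j - 1) \<in> measurable M (count_space UNIV)"
    and b: "frozen_count w (k + 1) (j - 1) \<in> measurable M (count_space UNIV)"
    by (intro frozen_count_measurable)+
  have x: "w j t \<in> measurable M (count_space UNIV)"
    and y: "w j (t - 1) \<in> measurable M (count_space UNIV)"
    using assms by (auto intro!: w_measurable)
  have ab: "(\<lambda>\<omega>. (frozen_count w k (j - 1) \<omega>, frozen_count w (k + 1) (j - 1) \<omega>))
      \<in> measurable M (count_space UNIV)"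
    by (rule measurable_countable_compose2[where h = Pair, OF a b]) simp
  have xy: "(\<lambda>\<omega>. (w j t \<omega>, w j (t - 1) \<omega>)) \<in> measurable M (count_space UNIV)"
    by (rule measurable_countable_compose2[where h = Pair, OF x y]) simp
  have "(\<lambda>\<omega>. (\<lambda>(a, b) (x, y). if b \<ge> n then pot n a b
     else pot n (a + of_bool (x \<le> k)) (b + of_bool (x = k + 1 \<and> y = k + 1)))
      (frozen_count w k (j - 1) \<omega>, frozen_count w (k + 1) (j - 1) \<omega>) (w j t \<omega>, w j (t - 1) \<omega>))
      \<in> borel_measurable M"
    by (rule measurable_countable_compose2[OF ab xy]) simp
  then show ?thesis unfolding walk_pot_def[abs_def] Let_def prod.case .
qed

lemma walk_pot_bounds: "0 \<le> walk_pot k j t \<omega>" "walk_pot k j t \<omega> \<le> weight n n"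
  by (auto simp: walk_pot_def Let_def pot_nonneg pot_le)

lemma walk_pot_integrable:
  "j \<ge> 1 \<Longrightarrow> t \<ge> 2 \<Longrightarrow> integrable M (walk_pot k j t)"
  by (intro integrable_const_bound[of _ "weight n n"] walk_pot_measurable)
    (auto simp: walk_pot_bounds)

text \<open>The increment is bounded pathwise by the contributions of stepping left from
  \<open>k + 1\<close> and of freezing there. Their joint expectation is nonpositive by
  \<open>integral_cond_prob\<close> and \<open>pot_step\<close>.\<close>

lemma walk_pot_step:
  assumes j: "j > 1" and t: "t \<ge> 2"
  shows "(\<integral>\<omega>. walk_pot k j (t + 1) \<omega> \<partial>M) \<le> (\<integral>\<omega>. walk_pot k j t \<omega> \<partial>M)"
proof -
  have jt: "j \<ge> 1" "t \<ge> 1" using j t by auto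
  define a b where "a = frozen_count w k (j - 1)" and "b = frozen_count w (k + 1) (j - 1)"
  \<comment> \<open>The situation in which the potential has a random drift: the particle is moving,
    stands at \<open>k + 1\<close>, and that site is not full. \<open>F1\<close> and
    \<open>F2\<close> are the changes of the potential on stepping left and on freezing.\<close>
  define C where "C \<omega> \<longleftrightarrow> w j t \<omega> \<noteq> w j (t - 1) \<omega> \<and> w j t \<omega> = k + 1 \<and> b \<omega> < n" for \<omega>
  define F1 where "F1 \<omega> = of_bool (C \<omega>) * (pot n (Suc (a \<omega>)) (b \<omega>) - pot n (a \<omega>) (b \<omega>))" for \<omega>
  define F2 where "F2 \<omega> = of_bool (C \<omega>) * (pot n (a \<omega>) (Suc (b \<omega>)) - pot n (a \<omega>) (b \<omega>))" for \<omega>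
  let ?f = "\<lambda>\<omega>. real (frozen_count w (w j t \<omega> - 1) (j - 1) \<omega>)"
  let ?S = "\<lambda>d. {\<omega> \<in> space M. w j (t + 1) \<omega> = w j t \<omega> + d}"
  let ?H = "dla_history M w j t"
  have [measurable]: "a \<in> measurable ?H (count_space UNIV)" "b \<in> measurable ?H (count_space UNIV)"
    unfolding a_def b_def by (intro frozen_count_history jt)+
  note unfrozen_history[OF jt(1) t, measurable]
  have [measurable]: "w j t \<in> measurable ?H (count_space UNIV)"
    using jt by (auto intro!: measurable_dla_history)
  have C[measurable]: "Measurable.pred ?H C"
    unfolding C_def by measurable
  have [measurable]: "(\<lambda>\<omega>. pot n (Suc (a \<omega>)) (b \<omega>)) \<in> borel_measurable ?H"
    "(\<lambda>\<omega>. pot n (a \<omega>) (b \<omega>)) \<in> borel_measurable ?H"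
    "(\<lambda>\<omega>. pot n (a \<omega>) (Suc (b \<omega>))) \<in> borel_measurable ?H"
    by (rule measurable_countable_compose2[where f = a and g = b and h = "\<lambda>x y. pot n (Suc x) y"]
        measurable_countable_compose2[where f = a and g = b and h = "pot n"]
        measurable_countable_compose2[where f = a and g = b and h = "\<lambda>x y. pot n x (Suc y)"]; simp)+
  have F: "F1 \<in> borel_measurable ?H" "F2 \<in> borel_measurable ?H"
    unfolding F1_def F2_def by measurable
  have bd: "\<bar>pot n p q - pot n r s\<bar> \<le> weight n n" for p q r s
    using pot_nonneg[of n p q] pot_nonneg[of n r s] pot_le[of n p q] pot_le[of n r s] by linarith
  have F_bd: "\<bar>F1 \<omega>\<bar> \<le> weight n n" "\<bar>F2 \<omega>\<bar> \<le> weight n n" for \<omega>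
    using bd weight_ge_1[of n n] by (auto simp: F1_def F2_def)
  note frozen_count_at_measurable[OF jt, measurable]
  have p: "(\<lambda>\<omega>. (real n - ?f \<omega>) / (2 * real n)) \<in> borel_measurable M"
    "(\<lambda>\<omega>. ?f \<omega> / real n) \<in> borel_measurable M" by measurable
  have AE_l: "AE \<omega> in M. F1 \<omega> \<noteq> 0 \<longrightarrow>
      real_cond_exp M ?H (indicator (?S (-1))) \<omega> = (real n - ?f \<omega>) / (2 * real n)"
    using step_left[OF j t] by eventually_elim (simp add: F1_def C_def)
  have AE_s: "AE \<omega> in M. F2 \<omega> \<noteq> 0 \<longrightarrow>
      real_cond_exp M ?H (indicator (?S 0)) \<omega> = ?f \<omega> / real n"
    using step_stay[OF j t] by eventually_elim (simp add: F2_def C_def)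
  note l = integral_cond_prob[OF jt F(1) F_bd(1) sets_step[OF jt] p(1) AE_l]
  note s = integral_cond_prob[OF jt F(2) F_bd(2) sets_step[OF jt] p(2) AE_s]
  note sub = subalgebra_dla_history[OF jt]
  have FM[measurable]: "F1 \<in> borel_measurable M" "F2 \<in> borel_measurable M"
    using F measurable_from_subalg[OF sub] by auto
  \<comment> \<open>The bounds here are crude and serve integrability only.\<close>
  have f_bd: "\<bar>?f \<omega>\<bar> \<le> real j" for \<omega>
    using frozen_count_le[of "w j t \<omega> - 1" "j - 1" \<omega>] by auto
  have p_bd: "\<bar>(real n - ?f \<omega>) / (2 * real n)\<bar> \<le> real n + real j"
    "\<bar>?f \<omega> / real n\<bar> \<le> real n + real j" for \<omega>
  proof -
    have aux: "\<bar>real n - x\<bar> \<le> real n + y" if "\<bar>x\<bar> \<le> y" for x y using that by linarith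
    have "\<bar>real n - ?f \<omega>\<bar> \<le> (real n + real j) * 1"
      using aux[OF f_bd[of \<omega>]] by simp
    also have "\<dots> \<le> (real n + real j) * (2 * real n)" using n_pos by (intro mult_left_mono) auto
    finally show "\<bar>(real n - ?f \<omega>) / (2 * real n)\<bar> \<le> real n + real j"
      using n_pos by (simp add: abs_divide divide_le_eq)
    have "\<bar>?f \<omega>\<bar> \<le> (real n + real j) * 1" using order_trans[OF f_bd[of \<omega>]] by simp
    also have "\<dots> \<le> (real n + real j) * real n" using n_pos by (intro mult_left_mono) auto
    finally show "\<bar>?f \<omega> / real n\<bar> \<le> real n + real j"
      using n_pos by (simp add: abs_divide divide_le_eq)
  qed
  have prod_bd: "\<bar>x * y\<bar> \<le> weight n n * (real n + real j)"
    if "\<bar>x\<bar> \<le> weight n n" "\<bar>y\<bar> \<le> real n + real j" for x y :: real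
    unfolding abs_mult using that weight_ge_1[of n n] by (intro mult_mono) auto
  have int: "integrable M (\<lambda>\<omega>. F1 \<omega> * ((real n - ?f \<omega>) / (2 * real n)))"
    "integrable M (\<lambda>\<omega>. F2 \<omega> * (?f \<omega> / real n))"
    by (rule integrable_const_bound[of _ "weight n n * (real n + real j)"],
        simp only: real_norm_def, intro AE_I2 prod_bd F_bd p_bd,
        intro borel_measurable_times FM p)+
  have "(\<integral>\<omega>. F1 \<omega> * indicator (?S (-1)) \<omega> \<partial>M) + (\<integral>\<omega>. F2 \<omega> * indicator (?S 0) \<omega> \<partial>M)
      = (\<integral>\<omega>. F1 \<omega> * ((real n - ?f \<omega>) / (2 * real n)) + F2 \<omega> * (?f \<omega> / real n) \<partial>M)"
    unfolding l(1) s(1) using int by simp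
  also have "\<dots> \<le> 0"
  proof -
    have "F1 \<omega> * ((real n - ?f \<omega>) / (2 * real n)) + F2 \<omega> * (?f \<omega> / real n) \<le> 0" for \<omega>
    proof (cases "C \<omega>")
      case True
      then have "?f \<omega> = a \<omega>" "b \<omega> < n" by (simp_all add: C_def a_def)
      then show ?thesis
        using pot_step[of "b \<omega>" n "a \<omega>"] True by (simp add: F1_def F2_def mult.commute)
    qed (simp add: F1_def F2_def)
    then show ?thesis
      using integral_mono[OF Bochner_Integration.integrable_add[OF int] integrable_zero] by simp
  qed
  finally have drift: "(\<integral>\<omega>. F1 \<omega> * indicator (?S (-1)) \<omega> \<partial>M) + (\<integral>\<omega>. F2 \<omega> * indicator (?S 0) \<omega> \<partial>M) \<le> 0" .
  \<comment> \<open>Away from \<open>C\<close> the potential can change only when a moving particle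
    steps from \<open>k\<close> back to \<open>k + 1\<close>, which does not raise it. Arrival at
    \<open>k + 1\<close> from \<open>k + 2\<close> is not mistaken for freezing, because
    \<open>walk_pot\<close> compares two consecutive positions.\<close>
  have "AE \<omega> in M. walk_pot k j (t + 1) \<omega> \<le>
    walk_pot k j t \<omega> + (F1 \<omega> * indicator (?S (-1)) \<omega> + F2 \<omega> * indicator (?S 0) \<omega>)"
    using AE_nearest_neighbour[OF j t] frozen[OF j t] AE_space
  proof eventually_elim
    case (elim \<omega>)
    have wp: "walk_pot k j s \<omega> = (if b \<omega> \<ge> n then pot n (a \<omega>) (b \<omega>)
     else pot n (a \<omega> + of_bool (w j s \<omega> \<le> k)) (b \<omega> + of_bool (w j s \<omega> = k + 1 \<and> w j (s - 1) \<omega> = k + 1)))" for s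
      by (simp add: walk_pot_def a_def b_def Let_def)
    show ?case
    proof (cases "w j t \<omega> = w j (t - 1) \<omega>")
      case True
      then have "w j (t + 1) \<omega> = w j t \<omega>" using elim by simp
      then show ?thesis using True unfolding wp by (simp add: F1_def F2_def C_def)
    next
      case False
      then have nn: "w j (t + 1) \<omega> \<in> {w j t \<omega> + 1, w j t \<omega> - 1, w j t \<omega>}" using elim by simp
      consider "b \<omega> \<ge> n" | "b \<omega> < n" "w j t \<omega> < k" | "b \<omega> < n" "w j t \<omega> = k"
        | "b \<omega> < n" "w j t \<omega> = k + 1" | "b \<omega> < n" "w j t \<omega> > k + 1" by linarith
      then show ?thesis
      proof cases
        case 3
        then show ?thesis using nn False pot_Suc_left[of n "a \<omega>" "b \<omega>"] unfolding wp
          by (auto simp: F1_def F2_def C_def)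
      next
        case 4
        then show ?thesis using nn False elim(3) unfolding wp
          by (auto simp: F1_def F2_def C_def indicator_def)
      qed (use nn False in \<open>auto simp: wp F1_def F2_def C_def\<close>)
    qed
  qed
  then have "(\<integral>\<omega>. walk_pot k j (t + 1) \<omega> \<partial>M) \<le>
    (\<integral>\<omega>. walk_pot k j t \<omega> + (F1 \<omega> * indicator (?S (-1)) \<omega> + F2 \<omega> * indicator (?S 0) \<omega>) \<partial>M)"
    using jt t by (intro integral_mono_AE walk_pot_integrable Bochner_Integration.integrable_add l(2) s(2)) auto
  also have "\<dots> = (\<integral>\<omega>. walk_pot k j t \<omega> \<partial>M) + ((\<integral>\<omega>. F1 \<omega> * indicator (?S (-1)) \<omega> \<partial>M)
     + (\<integral>\<omega>. F2 \<omega> * indicator (?S 0) \<omega> \<partial>M))"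
    using l(2) s(2) walk_pot_integrable[OF jt(1) t] by simp
  finally show ?thesis using drift by simp
qed

section \<open>From one particle to the next\<close>

lemma site_pot_bounds: "0 \<le> site_pot k j \<omega>" "site_pot k j \<omega> \<le> weight n n"
  by (auto simp: site_pot_def pot_nonneg pot_le)

lemma site_pot_integrable: "integrable M (site_pot k j)"
  by (intro integrable_const_bound[of _ "weight n n"] site_pot_measurable)
    (auto simp: site_pot_bounds)

text \<open>If the starting point \<open>j + 1\<close> is at most \<open>k\<close>, then by
  \<open>supported\<close> no earlier particle has frozen at \<open>k\<close>, and
  \<open>pot_0_1\<close> absorbs the premature count. Otherwise neither correction in
  \<open>walk_pot\<close> is active, as the positions at times \<open>1\<close> and \<open>2\<close>
  differ.\<close>

lemma walk_pot_start:
  assumes n: "n \<ge> 2" and j: "j > 1" and k: "k \<ge> 1"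
  shows "AE \<omega> in M. walk_pot k j 2 \<omega> = site_pot k (j - 1) \<omega>"
  using start[OF j] AE_support
proof eventually_elim
  case (elim \<omega>)
  have "frozen_count w k (j - 1) \<omega> = 0" if "int j + 1 \<le> k"
  proof -
    have "\<not> freezes_at w i k \<omega>" if "i \<in> {1..j-1}" for i
    proof
      assume f: "freezes_at w i k \<omega>"
      show False
      proof (cases "i = 1")
        case True
        then show False using f elim(2) freezes_at_unique[of 1 0 \<omega> k] k
          by (auto simp: supported_def)
      next
        case False
        then have "i \<ge> 2" using that by auto
        then have "k < int i" using f elim(2) unfolding supported_def by blast
        then show False using that \<open>int j + 1 \<le> k\<close> by auto
      qed
    qed
    then show ?thesis unfolding frozen_count_def by auto
  qed
  then show ?case
    using elim(1) pot_0_1[OF n] by (auto simp: walk_pot_def site_pot_def Let_def)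
qed

text \<open>Freezing at \<open>k\<close> or at \<open>k + 1\<close> is eventually recorded by
  \<open>walk_pot\<close> when \<open>k + 1\<close> is not yet full. If \<open>k + 1\<close> is
  already full, the particle cannot freeze at \<open>k\<close>, and freezing at \<open>k + 1\<close>
  only lowers the potential. In the remaining case \<open>walk_pot\<close> can err only by an extra
  count at \<open>k\<close>, which goes upwards.\<close>

lemma walk_pot_limit:
  assumes j: "j > 1"
  shows "AE \<omega> in M. \<forall>\<^sub>F t in sequentially. site_pot k j \<omega> \<le> walk_pot k j t \<omega>"
proof -
  have "AE \<omega> in M. \<forall>t\<in>{2..}. w j t \<omega> = w j (t - 1) \<omega> \<longrightarrow> w j (t + 1) \<omega> = w j t \<omega>"
    using frozen[OF j] by (intro AE_ball_countable[THEN iffD2] ballI) auto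
  from this AE_not_freezes_beyond_full_site[OF j, of k] show ?thesis
  proof eventually_elim
    case (elim \<omega>)
    have frz: "w j t \<omega> = w j (t - 1) \<omega> \<longrightarrow> w j (t + 1) \<omega> = w j t \<omega>" if "t \<ge> 2" for t
      using elim(1) that by blast
    note elim = elim(2)
    let ?a = "frozen_count w k (j - 1) \<omega>" and ?b = "frozen_count w (k + 1) (j - 1) \<omega>"
    have a: "frozen_count w k j \<omega> = ?a + of_bool (freezes_at w j k \<omega>)"
      and b: "frozen_count w (k + 1) j \<omega> = ?b + of_bool (freezes_at w j (k + 1) \<omega>)"
      using frozen_count_Suc[of _ "j - 1"] j by simp_all
    consider "?b \<ge> n" | "?b < n" "freezes_at w j k \<omega>" | "?b < n" "freezes_at w j (k + 1) \<omega>"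
      | "?b < n" "\<not> freezes_at w j k \<omega>" "\<not> freezes_at w j (k + 1) \<omega>" by linarith
    then show ?case
    proof cases
      case 1
      then have "site_pot k j \<omega> \<le> walk_pot k j t \<omega>" for t
        using elim pot_Suc_right[of n ?a ?b] unfolding site_pot_def walk_pot_def Let_def a b by simp
      then show ?thesis by simp
    next
      case 2
      then have nf: "\<not> freezes_at w j (k + 1) \<omega>" using freezes_at_unique[of j k \<omega> "k + 1"] by auto
      have "\<forall>\<^sub>F t in sequentially. w j t \<omega> = k"
        using 2 unfolding freezes_at_def by (simp add: tendsto_discrete)
      then show ?thesis
      proof eventually_elim
        case (elim t)
        then show ?case using 2 nf unfolding site_pot_def walk_pot_def Let_def a b by simp
      qed
    next
      case 3
      then have nf: "\<not> freezes_at w j k \<omega>" using freezes_at_unique[of j k \<omega> "k + 1"] by auto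
      have ev: "\<forall>\<^sub>F t in sequentially. w j t \<omega> = k + 1"
        using 3 unfolding freezes_at_def by (simp add: tendsto_discrete)
      then have "\<forall>\<^sub>F t in sequentially. w j (t - 1) \<omega> = k + 1"
        by (rule eventually_compose_filterlim) (rule filterlim_minus_const_nat_at_top)
      with ev show ?thesis
      proof eventually_elim
        case (elim t)
        then show ?case using 3 nf unfolding site_pot_def walk_pot_def Let_def a b by simp
      qed
    next
      case 4
      have "site_pot k j \<omega> \<le> walk_pot k j t \<omega>" if "\<not> (w j t \<omega> = k + 1 \<and> w j (t - 1) \<omega> = k + 1)" for t
        using 4 that pot_Suc_left[of n ?a ?b] unfolding site_pot_def walk_pot_def a b
        by (auto simp: Let_def)
      \<comment> \<open>Two equal consecutive positions persist forever, so they would mean freezing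
        at \<open>k + 1\<close>.\<close>
      moreover have "\<not> (w j t \<omega> = k + 1 \<and> w j (t - 1) \<omega> = k + 1)" if "t \<ge> 2" for t
      proof
        assume eq: "w j t \<omega> = k + 1 \<and> w j (t - 1) \<omega> = k + 1"
        have stay: "w j s \<omega> = w j (t - 1) \<omega>" if "s \<ge> t - 1" for s
        proof (rule frozen_stays[where t = "t - 1"])
          show "w j r \<omega> = w j (r - 1) \<omega> \<longrightarrow> w j (r + 1) \<omega> = w j r \<omega>" if "r \<ge> 2" for r
            by (rule frz[OF that])
        qed (use \<open>t \<ge> 2\<close> eq that in auto)
        have "w j s \<omega> = k + 1" if "s \<ge> t - 1" for s
          using stay[OF that] eq by simp
        moreover have "1 \<le> t - 1" using \<open>t \<ge> 2\<close> by simp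
        ultimately have "freezes_at w j (k + 1) \<omega>"
          unfolding freezes_at_iff by blast
        then show False using 4 by simp
      qed
      ultimately show ?thesis
        unfolding eventually_sequentially by (intro exI[of _ 2] allI impI) simp
    qed
  qed
qed

text \<open>The expectation starts at the old site potential, does not increase along the walk, and
  dominates the new site potential in the limit; dominated convergence joins these facts.\<close>

lemma site_pot_antimono:
  assumes n: "n \<ge> 2" and j: "j > 1" and k: "k \<ge> 1"
  shows "(\<integral>\<omega>. site_pot k j \<omega> \<partial>M) \<le> (\<integral>\<omega>. site_pot k (j - 1) \<omega> \<partial>M)"
proof -
  \<comment> \<open>\<open>walk_pot\<close> need not converge (an unfrozen particle may cross \<open>k\<close> forever); its minimum with
    the limiting lower bound does.\<close>
  let ?Z = "\<lambda>t \<omega>. min (walk_pot k j (t + 2) \<omega>) (site_pot k j \<omega>)"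
  have wm: "walk_pot k j (t + 2) \<in> borel_measurable M" for t
    using j by (intro walk_pot_measurable) auto
  have Zm: "?Z t \<in> borel_measurable M" for t
    by (intro borel_measurable_min wm site_pot_measurable)
  have lim: "AE \<omega> in M. (\<lambda>t. ?Z t \<omega>) \<longlonglongrightarrow> site_pot k j \<omega>"
    using walk_pot_limit[OF j, of k]
  proof eventually_elim
    case (elim \<omega>)
    then have "\<forall>\<^sub>F t in sequentially. site_pot k j \<omega> \<le> walk_pot k j (t + 2) \<omega>"
      by (rule sequentially_offset)
    then have "\<forall>\<^sub>F t in sequentially. ?Z t \<omega> = site_pot k j \<omega>"
      by eventually_elim simp
    then show ?case by (rule tendsto_eventually)
  qed
  have Z_bd: "norm (?Z t \<omega>) \<le> weight n n" for t \<omega>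
    using walk_pot_bounds[of k j "t + 2" \<omega>] site_pot_bounds[of k j \<omega>] by auto
  have "(\<lambda>t. \<integral>\<omega>. ?Z t \<omega> \<partial>M) \<longlonglongrightarrow> (\<integral>\<omega>. site_pot k j \<omega> \<partial>M)"
    by (rule integral_dominated_convergence[OF site_pot_measurable Zm _ lim])
      (use Z_bd in auto)
  moreover have "(\<integral>\<omega>. ?Z t \<omega> \<partial>M) \<le> (\<integral>\<omega>. site_pot k (j - 1) \<omega> \<partial>M)" for t
  proof -
    have "(\<integral>\<omega>. ?Z t \<omega> \<partial>M) \<le> (\<integral>\<omega>. walk_pot k j (t + 2) \<omega> \<partial>M)"
    proof (rule integral_mono)
      show "integrable M (?Z t)"
        by (rule integrable_const_bound[OF AE_I2[OF Z_bd] Zm])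
      show "integrable M (walk_pot k j (t + 2))"
        using j by (intro walk_pot_integrable) auto
    qed simp
    also have "\<dots> \<le> (\<integral>\<omega>. walk_pot k j 2 \<omega> \<partial>M)"
    proof (induction t)
      case (Suc t)
      then show ?case using walk_pot_step[OF j, of "t + 2" k] by simp
    qed (simp add: numeral_2_eq_2)
    also have "\<dots> = (\<integral>\<omega>. site_pot k (j - 1) \<omega> \<partial>M)"
      using j by (intro integral_cong_AE walk_pot_measurable site_pot_measurable walk_pot_start[OF n j k]) auto
    finally show ?thesis .
  qed
  ultimately show ?thesis by (intro LIMSEQ_le_const2) auto
qed

text \<open>Particle \<open>1\<close> sits at \<open>0\<close>, so for \<open>k \<ge> 1\<close> both
  counts vanish initially and the potential is \<open>1\<close>.\<close>

lemma site_pot_integral_le: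
  assumes n: "n \<ge> 2" and j: "j \<ge> 1" and k: "k \<ge> 1"
  shows "(\<integral>\<omega>. site_pot k j \<omega> \<partial>M) \<le> 1"
  using j
proof (induction rule: dec_induct)
  case base
  have "AE \<omega> in M. site_pot k 1 \<omega> = 1"
    using AE_support
  proof eventually_elim
    case (elim \<omega>)
    have "frozen_count w l 1 \<omega> = 0" if "l \<ge> 1" for l
    proof -
      have "\<not> freezes_at w 1 l \<omega>"
        using elim that freezes_at_unique[of 1 0 \<omega> l] unfolding supported_def by auto
      then have "{i' \<in> {1..1}. freezes_at w i' l \<omega>} = {}" by auto
      then show ?thesis unfolding frozen_count_def by (simp only: card.empty)
    qed
    then show ?case using k n by (simp add: site_pot_def pot_def)
  qed
  then have "(\<integral>\<omega>. site_pot k 1 \<omega> \<partial>M) = (\<integral>\<omega>. 1 \<partial>M)"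
    by (intro integral_cong_AE) auto
  then show ?case by (simp add: prob_space)
next
  case (step j)
  then show ?case using site_pot_antimono[OF n _ k, of "Suc j"] by simp
qed

section \<open>Tail bound at one site and union bound\<close>

text \<open>Markov's inequality for \<open>site_pot\<close>: once \<open>k\<close> holds
  \<open>n\<close> particles, the potential is at least \<open>L\<close>, whatever the count at
  \<open>k + 1\<close>.\<close>

lemma prob_frozen_count_ge:
  assumes n: "n \<ge> 2" and j: "j \<ge> 1" and k: "k \<ge> 1"
  shows "prob {\<omega> \<in> space M. frozen_count w k j \<omega> \<ge> n} \<le> (19/20) ^ n"
proof -
  let ?A = "{\<omega> \<in> space M. frozen_count w k j \<omega> \<ge> n}"
  define L where "L = weight n n * (3/4) ^ (n - 1)"
  have L: "(20/19) ^ n \<le> L" unfolding L_def by (rule weight_bound[OF n])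
  note frozen_count_measurable[measurable]
  have A: "?A \<in> sets M" by measurable
  have "L * prob ?A = (\<integral>\<omega>. L * indicator ?A \<omega> \<partial>M)"
    using A by simp
  also have "\<dots> \<le> (\<integral>\<omega>. site_pot k j \<omega> \<partial>M)"
  proof (rule integral_mono)
    show "integrable M (\<lambda>\<omega>. L * indicator ?A \<omega>)"
      using A by (intro integrable_mult_right) (simp add: emeasure_eq_measure)
    show "L * indicator ?A \<omega> \<le> site_pot k j \<omega>" for \<omega>
      using pot_ge[of n "frozen_count w k j \<omega>"] site_pot_bounds[of k j \<omega>]
      by (auto simp: indicator_def L_def site_pot_def)
  qed (rule site_pot_integrable)
  also have "\<dots> \<le> 1" by (rule site_pot_integral_le[OF n j k])
  finally have "L * prob ?A \<le> 1" .
  moreover have "(20/19) ^ n * prob ?A \<le> L * prob ?A"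
    by (intro mult_right_mono L) simp
  ultimately have "(20/19) ^ n * prob ?A \<le> 1" by linarith
  then show ?thesis by (simp add: power_divide field_simps)
qed

lemma prob_blockage:
  assumes n: "n \<ge> 2" and k: "k \<ge> 1"
  shows "prob {\<omega> \<in> space M. blockage n w k \<omega>} \<le> (19/20) ^ n"
proof -
  \<comment> \<open>Replacing the equality in \<open>blockage\<close> by \<open>\<ge>\<close> makes
    the events increase with \<open>i\<close>, so the bound, uniform in the label, passes to their
    union. The successor keeps labels at least \<open>1\<close>.\<close>
  let ?A = "\<lambda>i. {\<omega> \<in> space M. frozen_count w k (Suc i) \<omega> \<ge> n}"
  note frozen_count_measurable[measurable]
  have A: "?A i \<in> sets M" for i by measurable
  have mono: "frozen_count w k i \<omega> \<le> frozen_count w k (Suc i) \<omega>" for i \<omega>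
    by (simp add: frozen_count_Suc)
  have inc: "incseq ?A"
    using mono by (intro incseq_SucI) (auto intro: order_trans)
  have "prob {\<omega> \<in> space M. blockage n w k \<omega>} \<le> prob (\<Union>i. ?A i)"
  proof (rule finite_measure_mono)
    show "{\<omega> \<in> space M. blockage n w k \<omega>} \<subseteq> (\<Union>i. ?A i)"
      using mono by (fastforce simp: blockage_def)
  qed (use A in auto)
  also have "\<dots> \<le> (19/20) ^ n"
  proof (rule LIMSEQ_le_const2[OF finite_Lim_measure_incseq[OF _ inc]])
    show "range ?A \<subseteq> sets M" using A by auto
    show "\<exists>N. \<forall>i\<ge>N. prob (?A i) \<le> (19/20) ^ n"
      using prob_frozen_count_ge[OF n _ k] by simp
  qed
  finally show ?thesis .
qed

text \<open>At sites up to \<open>0\<close> only particle \<open>1\<close> can freeze, and one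
  particle is no blockage when \<open>n \<ge> 2\<close>.\<close>

lemma AE_blockage_pos:
  assumes n: "n \<ge> 2"
  shows "AE \<omega> in M. \<forall>k. blockage n w k \<omega> \<longrightarrow> k \<ge> 1"
  using AE_support
proof eventually_elim
  case (elim \<omega>)
  show ?case
  proof (intro allI impI)
    fix k assume "blockage n w k \<omega>"
    then obtain i where i: "card {i' \<in> {1..i}. freezes_at w i' k \<omega>} = n"
      unfolding blockage_def frozen_count_def by auto
    show "k \<ge> 1"
    proof (rule ccontr)
      assume "\<not> k \<ge> 1"
      then have "i' \<in> {1}" if "freezes_at w i' k \<omega>" "i' \<ge> 1" for i'
        using elim that unfolding supported_def by (cases "i' \<ge> 2") auto
      then have "{i' \<in> {1..i}. freezes_at w i' k \<omega>} \<subseteq> {1}" by auto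
      then have "card {i' \<in> {1..i}. freezes_at w i' k \<omega>} \<le> card {1::nat}"
        by (intro card_mono) auto
      then show False using i n by simp
    qed
  qed
qed

lemma prob_leftmost_blockage_less:
  assumes n: "n \<ge> 2" and x: "x > 0"
  shows "prob {\<omega> \<in> space M. leftmost_blockage n w \<omega> < ereal x} < x * (19/20) ^ n"
proof -
  let ?B = "\<lambda>k. {\<omega> \<in> space M. blockage n w k \<omega>}"
  \<comment> \<open>These are the integers in \<open>[1, x)\<close>. There are strictly fewer than
    \<open>x\<close> of them, which is the source of the strict inequality.\<close>
  let ?K = "{1..\<lceil>x\<rceil> - 1}"
  note pred_blockage[measurable]
  have B: "?B k \<in> sets M" for k by measurable
  have "prob {\<omega> \<in> space M. leftmost_blockage n w \<omega> < ereal x} \<le> prob (\<Union>k\<in>?K. ?B k)"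
  proof (rule finite_measure_mono_AE)
    show "AE \<omega> in M. \<omega> \<in> {\<omega> \<in> space M. leftmost_blockage n w \<omega> < ereal x} \<longrightarrow> \<omega> \<in> (\<Union>k\<in>?K. ?B k)"
      using AE_blockage_pos[OF n]
    proof eventually_elim
      case (elim \<omega>)
      show ?case
      proof
        assume a: "\<omega> \<in> {\<omega> \<in> space M. leftmost_blockage n w \<omega> < ereal x}"
        then obtain k where k: "blockage n w k \<omega>" "real_of_int k < x"
          unfolding leftmost_blockage_less_iff by auto
        then have "k \<in> ?K" using elim by (auto simp: less_ceiling_iff)
        then show "\<omega> \<in> (\<Union>k\<in>?K. ?B k)" using k a by auto
      qed
    qed
  qed (use B in auto)
  also have "\<dots> \<le> (\<Sum>k\<in>?K. prob (?B k))"
    by (rule finite_measure_subadditive_finite) (use B in auto)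
  also have "\<dots> \<le> (\<Sum>k\<in>?K. (19/20) ^ n)"
    by (intro sum_mono prob_blockage[OF n]) auto
  also have "\<dots> = real (card ?K) * (19/20) ^ n" by simp
  also have "\<dots> < x * (19/20) ^ n"
  proof (rule mult_strict_right_mono)
    have "\<lceil>x\<rceil> \<ge> 1" using x by simp
    then have "real (card ?K) = real_of_int (\<lceil>x\<rceil> - 1)" by simp
    also have "\<dots> < x" by linarith
    finally show "real (card ?K) < x" .
  qed simp
  finally show ?thesis .
qed

end

text \<open>The range starts at \<open>n = 2\<close> because for \<open>n = 1\<close> the
  probability equals \<open>1\<close> by \<open>prob_leftmost_blockage_less_one\<close>.\<close>

theorem theorem2p1:
  shows "\<exists>c>0. \<forall>n\<ge>2. \<forall>(M :: 'a measure) w. dla_process M n w \<longrightarrow>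
    measure M {\<omega> \<in> space M. leftmost_blockage n w \<omega> < ereal (exp (c * real n))} < exp (- c * real n)"
proof (intro exI conjI allI impI)
  \<comment> \<open>Half the rate of the single-site bound: the union over fewer than
    \<open>exp (c * real n)\<close> sites uses up one half, and the other half remains.\<close>
  define c where "c = ln (20/19 :: real) / 2"
  show "ln (20/19 :: real) / 2 > 0" by simp
  fix n :: nat and M :: "'a measure" and w
  assume n: "n \<ge> 2" and "dla_process M n w"
  then interpret dla_process M n w by simp
  have "exp (- (2 * c)) = (19/20 :: real)"
    by (simp add: c_def exp_minus)
  then have "(19/20 :: real) ^ n = exp (- (2 * c) * real n)"
    by (metis exp_of_nat2_mult)
  then have "exp (c * real n) * (19/20) ^ n = exp (- c * real n)"
    by (simp flip: exp_add)
  then show "measure M {\<omega> \<in> space M. leftmost_blockage n w \<omega> < ereal (exp (ln (20/19) / 2 * real n))}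
      < exp (- (ln (20/19) / 2) * real n)"
    using prob_leftmost_blockage_less[OF n, of "exp (c * real n)"] unfolding c_def by simp
qed

end
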